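(* Let $(\xi_i)_{i\in\mathbb{Z}}$ be a stationary sequence of real random variables with $\mathbb{E}|\xi_0|<\infty$ and $\mathbb{E}(\xi_0)=0$, let $\mathcal{I}$ be its invariant $\sigma$-field, let $(a_j)_{j\in\mathbb{Z}}$ be real numbers with $\sum_{j\in\mathbb{Z}}|a_j|<\infty$, and set $A=\sum_{j\in\mathbb{Z}}a_j$, $X_k=\sum_{j=-\infty}^{\infty}a_j\xi_{k-j}$, $S_k=\sum_{j=1}^kX_j$, $S_k^{(\xi)}=\sum_{j=1}^k\xi_j$. Let $p\geq 1$, let $(b_n)$ be a sequence of positive reals with $b_n\to\infty$, let $\eta$ be an $\mathcal{I}$-measurable random variable and let $W$ be a standard Brownian motion on $[0,1]$ independent of $\mathcal{I}$. If $$\mathbb{E}\Big(\sup_{0\leq t\leq 1}\big|b_n^{-1}S^{(\xi)}_{[nt]}-\eta W(t)\big|^p\Big)\to 0\quad\text{as } n\to\infty,$$ then $$\mathbb{E}\Big(\sup_{0\leq t\leq 1}\big|b_n^{-1}S_{[nt]}-\eta A W(t)\big|^p\Big)\to 0\quad\text{as } n\to\infty.$$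
   Context: $[x]$ denotes the integer part of $x$, and $S_0=S_0^{(\xi)}=0$. The probability space is assumed rich enough to support a standard Brownian motion independent of $\mathcal{I}$ (the innovations are redefined, without changing distributions, on such a space). *)

theory Defs
  imports "HOL-Probability.Probability"
begin

text \<open>Strict stationarity: the law of the whole two-sided sequence is invariant under every
  time shift.\<close>

definition stationary_sequence :: "'a measure \<Rightarrow> (int \<Rightarrow> 'a \<Rightarrow> real) \<Rightarrow> bool" where
  "stationary_sequence M \<xi> \<longleftrightarrow>
     (\<forall>i. \<xi> i \<in> borel_measurable M) \<and>
     (\<forall>h. distr M (\<Pi>\<^sub>M i\<in>UNIV. borel) (\<lambda>\<omega> i. \<xi> (i + h) \<omega>) =
          distr M (\<Pi>\<^sub>M i\<in>UNIV. borel) (\<lambda>\<omega> i. \<xi> i \<omega>))"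

text \<open>The events of the form \<open>\<xi> \<in> B\<close>, where \<open>B\<close> is a measurable set of two-sided
  sequences that is strictly invariant under the shift; no null sets are added.\<close>

definition invariant_field :: "'a measure \<Rightarrow> (int \<Rightarrow> 'a \<Rightarrow> real) \<Rightarrow> 'a measure" where
  "invariant_field M \<xi> = sigma (space M)
     {(\<lambda>\<omega> i. \<xi> i \<omega>) -` B \<inter> space M | B.
        B \<in> sets (\<Pi>\<^sub>M i\<in>UNIV. borel) \<and> (\<lambda>x i. x (i + 1)) -` B = B}"

lemma space_invariant_field [simp]: "space (invariant_field M \<xi>) = space M"
  unfolding invariant_field_def by (rule space_measure_of) auto

text \<open>The generating family is already a \<open>\<sigma>\<close>-algebra.\<close>

lemma sets_invariant_field:
  "sets (invariant_field M \<xi>) =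
     {(\<lambda>\<omega> i. \<xi> i \<omega>) -` B \<inter> space M | B.
        B \<in> sets (\<Pi>\<^sub>M i\<in>UNIV. borel) \<and> (\<lambda>x i. x (i + 1)) -` B = B}"
    (is "_ = ?G")
proof -
  let ?P = "\<Pi>\<^sub>M i\<in>(UNIV :: int set). (borel :: real measure)"
  have sp: "space ?P = UNIV"
    by (simp add: space_PiM)
  have "sigma_algebra (space M) ?G"
    unfolding sigma_algebra_iff2
  proof (intro conjI ballI allI impI)
    show "?G \<subseteq> Pow (space M)" by auto
    show "{} \<in> ?G"
      by (rule CollectI, rule exI[of _ "{}"]) auto
  next
    fix E assume "E \<in> ?G"
    then obtain B where B: "E = (\<lambda>\<omega> i. \<xi> i \<omega>) -` B \<inter> space M" "B \<in> sets ?P"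
        "(\<lambda>x i. x (i + 1)) -` B = B" by blast
    have "- B \<in> sets ?P"
      using sets.compl_sets[OF B(2)] sp by (simp add: Compl_eq_Diff_UNIV)
    moreover have "(\<lambda>x i. x (i + 1)) -` (- B) = - B"
      using B(3) by (simp add: vimage_Compl)
    moreover have "space M - E = (\<lambda>\<omega> i. \<xi> i \<omega>) -` (- B) \<inter> space M"
      using B(1) by auto
    ultimately show "space M - E \<in> ?G" by blast
  next
    fix E :: "nat \<Rightarrow> 'a set" assume "range E \<subseteq> ?G"
    then have "\<forall>n. \<exists>B. E n = (\<lambda>\<omega> i. \<xi> i \<omega>) -` B \<inter> space M \<and> B \<in> sets ?P \<and>
        (\<lambda>x i. x (i + 1)) -` B = B" by blast
    then obtain B where B: "\<And>n. E n = (\<lambda>\<omega> i. \<xi> i \<omega>) -` B n \<inter> space M"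
        "\<And>n. B n \<in> sets ?P" "\<And>n. (\<lambda>x i. x (i + 1)) -` B n = B n" by metis
    have "(\<Union>n. B n) \<in> sets ?P"
      using B(2) by blast
    moreover have "(\<lambda>x i. x (i + 1)) -` (\<Union>n. B n) = (\<Union>n. B n)"
      using B(3) by (simp add: vimage_UN)
    moreover have "(\<Union>n. E n) = (\<lambda>\<omega> i. \<xi> i \<omega>) -` (\<Union>n. B n) \<inter> space M"
      using B(1) by auto
    ultimately show "(\<Union>n. E n) \<in> ?G" by blast
  qed
  then have "sigma_sets (space M) ?G = ?G"
    by (rule sigma_algebra.sigma_sets_eq)
  then show ?thesis
    unfolding invariant_field_def by (subst sets_measure_of) auto
qed

definition standard_brownian_motion :: "'a measure \<Rightarrow> (real \<Rightarrow> 'a \<Rightarrow> real) \<Rightarrow> bool" where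
  "standard_brownian_motion M W \<longleftrightarrow>
     (\<forall>t\<in>{0..1}. W t \<in> borel_measurable M) \<and>
     (AE \<omega> in M. W 0 \<omega> = 0) \<and>
     (\<forall>(n::nat) (t::nat \<Rightarrow> real).
        0 \<le> t 0 \<and> (\<forall>i<n. t i < t (Suc i)) \<and> t n \<le> 1 \<longrightarrow>
        prob_space.indep_vars M (\<lambda>_. borel) (\<lambda>i \<omega>. W (t (Suc i)) \<omega> - W (t i) \<omega>) {..<n}) \<and>
     (\<forall>s t. 0 \<le> s \<and> s < t \<and> t \<le> 1 \<longrightarrow>
        distributed M lborel (\<lambda>\<omega>. W t \<omega> - W s \<omega>) (normal_density 0 (sqrt (t - s)))) \<and>
     (AE \<omega> in M. continuous_on {0..1} (\<lambda>t. W t \<omega>))"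

text \<open>The \<open>\<sigma>\<close>-field generated by the process on the time interval \<open>[0, 1]\<close>.\<close>

definition process_field :: "'a measure \<Rightarrow> (real \<Rightarrow> 'a \<Rightarrow> real) \<Rightarrow> 'a measure" where
  "process_field M W =
     vimage_algebra (space M) (\<lambda>\<omega>. \<lambda>t\<in>{0..1}. W t \<omega>) (\<Pi>\<^sub>M t\<in>{0..1}. borel)"

text \<open>The sum is over all integers. For absolutely summable \<open>a\<close> and a stationary integrable
  \<open>\<xi>\<close> it converges absolutely almost surely; where it does not converge its value is \<open>0\<close>.\<close>

definition linear_process ::
  "(int \<Rightarrow> real) \<Rightarrow> (int \<Rightarrow> 'a \<Rightarrow> real) \<Rightarrow> int \<Rightarrow> 'a \<Rightarrow> real" where
  "linear_process a \<xi> k \<omega> = (\<Sum>\<^sub>\<infinity>j\<in>UNIV. a j * \<xi> (k - j) \<omega>)"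

definition partial_sum :: "(int \<Rightarrow> 'a \<Rightarrow> real) \<Rightarrow> nat \<Rightarrow> 'a \<Rightarrow> real" where
  "partial_sum Y k \<omega> = (\<Sum>j=1..k. Y (int j) \<omega>)"

end

theory Submission
  imports Defs
begin

text \<open>Write \<open>X\<close> for the linear process. Its partial sum of order \<open>k\<close> is \<open>\<Sum>j. a j * S j k\<close>, where \<open>S j k\<close>
  is the sum of the \<open>k\<close> innovations \<open>\<xi> (1 - j), \<dots>, \<xi> (k - j)\<close>. With \<open>V t = \<eta> * W t\<close> and \<open>A = \<Sum>j. a j\<close>,
  the difference \<open>\<Sum>j. a j * S j k / b n - A * V t\<close> is \<open>\<Sum>j. a j * (S j k / b n - V t)\<close>. By Jensen's
  inequality (\<open>deviation_linear_combination_le\<close>) the \<open>p\<close>-th power of its supremum over \<open>t\<close> is at most a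
  constant times \<open>\<Sum>j. \<bar>a j\<bar> * D n j\<close>, where \<open>D n j\<close> is the \<open>p\<close>-th power of the uniform distance
  between the normalized partial sum process of the innovations shifted by \<open>- j\<close> and the
  unshifted limit \<open>V\<close>. After taking expectations, dominated convergence over \<open>j\<close> finishes the
  proof, provided that the expectation of \<open>D n j\<close> tends to \<open>0\<close> for every \<open>j\<close> and is bounded
  uniformly in \<open>j\<close> and large \<open>n\<close>.

  Convergence for each \<open>j\<close> (\<open>shifted_deviation_tendsto\<close>). A shift by one step changes each partial
  sum by two innovations. As \<open>V\<close> has continuous paths, a jump of the step process is at most twice
  its uniform distance from \<open>V\<close> (\<open>jump_le_deviation\<close>), so the hypothesis makes the largest
  innovation in \<open>1, \<dots>, n\<close> negligible compared with \<open>b n\<close> in the \<open>p\<close>-th mean. By stationarity the same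
  holds in every shifted window, and induction over the shift applies.

  Uniform bound (\<open>shifted_deviation_bounded\<close>). \<open>D n j\<close> is controlled by the supremum of \<open>V\<close> and the
  maximal normalized shifted partial sum. The law of the latter is independent of \<open>j\<close>, and
  the hypothesis, which is the case \<open>j = 0\<close>, bounds it in terms of the supremum of \<open>V\<close>. That supremum lies in \<open>L\<^sup>p\<close>: for a
  single large \<open>n\<close> the expectation in the hypothesis is finite, so the innovations lie in \<open>L\<^sup>p\<close> by
  the jump estimate, hence so do finitely many partial sums, and \<open>V\<close> is within \<open>L\<^sup>p\<close> distance of them.\<close>

section \<open>Convexity estimates for p-th powers in the extended nonnegative reals\<close>

definition abs_powr :: "real \<Rightarrow> real \<Rightarrow> ennreal" where
  "abs_powr p x = ennreal (\<bar>x\<bar> powr p)"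

lemma abs_powr_0 [simp]: "abs_powr p 0 = 0"
  by (simp add: abs_powr_def)

lemma abs_powr_minus_commute: "abs_powr p (x - y) = abs_powr p (y - x)"
  by (simp add: abs_powr_def abs_minus_commute)

lemma abs_powr_minus [simp]: "abs_powr p (- x) = abs_powr p x"
  by (simp add: abs_powr_def)

lemma measurable_abs_powr [measurable]: "abs_powr p \<in> borel_measurable borel"
  unfolding abs_powr_def [abs_def] by measurable

lemma tendsto_abs_powr:
  assumes "p > 0" "(f \<longlongrightarrow> x) F"
  shows "((\<lambda>y. abs_powr p (f y)) \<longlongrightarrow> abs_powr p x) F"
  unfolding abs_powr_def
  using assms by (intro tendsto_ennrealI tendsto_powr' tendsto_rabs tendsto_const) auto

lemma abs_powr_add_le:
  assumes "p \<ge> 0"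
  shows "abs_powr p (x + y) \<le> ennreal (2 powr p) * (abs_powr p x + abs_powr p y)"
proof -
  have "\<bar>x + y\<bar> powr p \<le> (2 * max \<bar>x\<bar> \<bar>y\<bar>) powr p"
    using assms by (intro powr_mono2) auto
  also have "\<dots> = 2 powr p * max \<bar>x\<bar> \<bar>y\<bar> powr p"
    by (simp add: powr_mult)
  also have "\<dots> \<le> 2 powr p * (\<bar>x\<bar> powr p + \<bar>y\<bar> powr p)"
    by (intro mult_left_mono) (auto simp: max_def)
  finally show ?thesis
    by (simp add: abs_powr_def ennreal_leI flip: ennreal_mult ennreal_plus)
qed

lemma abs_powr_diff_le:
  assumes "p \<ge> 0"
  shows "abs_powr p (x - y) \<le> ennreal (2 powr p) * (abs_powr p x + abs_powr p y)"
  using abs_powr_add_le [OF assms, of x "- y"] by simp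

text \<open>Jensen's inequality for the convex function \<open>x powr p\<close> with the normalized weights
  \<open>\<bar>a j\<bar> / T\<close>. The terms with \<open>a j = 0\<close> or \<open>x j = 0\<close> are removed beforehand: this makes the
  normalization possible, and it keeps all points in the open half-line, where convexity holds.\<close>

lemma powr_weighted_sum_le:
  fixes a x :: "'b \<Rightarrow> real"
  assumes "finite F" "p \<ge> 1"
  shows "\<bar>\<Sum>j\<in>F. a j * x j\<bar> powr p
           \<le> (\<Sum>j\<in>F. \<bar>a j\<bar>) powr (p - 1) * (\<Sum>j\<in>F. \<bar>a j\<bar> * \<bar>x j\<bar> powr p)"
proof -
  define G where "G = {j\<in>F. a j \<noteq> 0 \<and> x j \<noteq> 0}"
  define T where "T = (\<Sum>j\<in>G. \<bar>a j\<bar>)"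
  have G: "finite G" "G \<subseteq> F" using assms by (auto simp: G_def)
  have sG: "(\<Sum>j\<in>F. f j) = (\<Sum>j\<in>G. f j)" if "\<And>j. a j = 0 \<or> x j = 0 \<Longrightarrow> f j = 0" for f :: "'b \<Rightarrow> real"
    using that assms(1) by (intro sum.mono_neutral_right) (auto simp: G_def)
  show ?thesis
  proof (cases "G = {}")
    case True
    have "(\<Sum>j\<in>F. a j * x j) = 0" by (subst sG) (auto simp: True)
    then show ?thesis by (simp add: sum_nonneg)
  next
    case False
    have T: "T > 0" unfolding T_def using G False by (intro sum_pos) (auto simp: G_def)
    have w: "(\<Sum>j\<in>G. \<bar>a j\<bar> / T) = 1"
      using T by (simp add: T_def flip: sum_divide_distrib)
    have "(\<Sum>j\<in>G. (\<bar>a j\<bar> / T) *\<^sub>R \<bar>x j\<bar>) powr p \<le> (\<Sum>j\<in>G. (\<bar>a j\<bar> / T) * \<bar>x j\<bar> powr p)"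
      using T by (intro convex_on_sum [OF G(1) False powr_convex [OF assms(2)] w]) (auto simp: G_def)
    also have "(\<Sum>j\<in>G. (\<bar>a j\<bar> / T) *\<^sub>R \<bar>x j\<bar>) = (\<Sum>j\<in>G. \<bar>a j\<bar> * \<bar>x j\<bar>) / T"
      by (simp add: sum_divide_distrib)
    also have "(\<Sum>j\<in>G. (\<bar>a j\<bar> / T) * \<bar>x j\<bar> powr p) = (\<Sum>j\<in>G. \<bar>a j\<bar> * \<bar>x j\<bar> powr p) / T"
      by (simp add: sum_divide_distrib)
    finally have "(\<Sum>j\<in>G. \<bar>a j\<bar> * \<bar>x j\<bar>) powr p / T powr p \<le> (\<Sum>j\<in>G. \<bar>a j\<bar> * \<bar>x j\<bar> powr p) / T"
      by (simp add: powr_divide)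
    then have "(\<Sum>j\<in>G. \<bar>a j\<bar> * \<bar>x j\<bar>) powr p
        \<le> (T powr p / T) * (\<Sum>j\<in>G. \<bar>a j\<bar> * \<bar>x j\<bar> powr p)"
      using T by (simp add: field_simps)
    also have "T powr p / T = T powr (p - 1)"
      using T by (simp add: powr_diff)
    finally have "(\<Sum>j\<in>G. \<bar>a j\<bar> * \<bar>x j\<bar>) powr p \<le> T powr (p - 1) * (\<Sum>j\<in>G. \<bar>a j\<bar> * \<bar>x j\<bar> powr p)" .
    note jensen = this
    have "\<bar>\<Sum>j\<in>F. a j * x j\<bar> powr p \<le> (\<Sum>j\<in>G. \<bar>a j\<bar> * \<bar>x j\<bar>) powr p"
    proof (rule powr_mono2)
      have "\<bar>\<Sum>j\<in>G. a j * x j\<bar> \<le> (\<Sum>j\<in>G. \<bar>a j * x j\<bar>)" by (rule sum_abs)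
      then show "\<bar>\<Sum>j\<in>F. a j * x j\<bar> \<le> (\<Sum>j\<in>G. \<bar>a j\<bar> * \<bar>x j\<bar>)"
        by (subst sG) (auto simp: abs_mult)
    qed (use assms in auto)
    also note jensen
    also have "T powr (p - 1) * (\<Sum>j\<in>G. \<bar>a j\<bar> * \<bar>x j\<bar> powr p)
        \<le> (\<Sum>j\<in>F. \<bar>a j\<bar>) powr (p - 1) * (\<Sum>j\<in>G. \<bar>a j\<bar> * \<bar>x j\<bar> powr p)"
      using assms T G unfolding T_def
      by (intro mult_right_mono powr_mono2 sum_mono2 sum_nonneg) auto
    also have "(\<Sum>j\<in>G. \<bar>a j\<bar> * \<bar>x j\<bar> powr p) = (\<Sum>j\<in>F. \<bar>a j\<bar> * \<bar>x j\<bar> powr p)"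
      by (rule sG [symmetric]) auto
    finally show ?thesis .
  qed
qed

lemma sum_le_nn_integral_count_space:
  assumes "finite F"
  shows "(\<Sum>j\<in>F. f j) \<le> (\<integral>\<^sup>+j. f j \<partial>count_space UNIV)"
proof -
  have "(\<Sum>j\<in>F. f j) = (\<integral>\<^sup>+j. f j \<partial>count_space F)"
    using assms by (simp add: nn_integral_count_space_finite)
  also have "\<dots> = (\<integral>\<^sup>+j. f j * indicator F j \<partial>count_space UNIV)"
    by (simp add: nn_integral_restrict_space [symmetric] restrict_count_space)
  also have "\<dots> \<le> (\<integral>\<^sup>+j. f j \<partial>count_space UNIV)"
    by (intro nn_integral_mono) (simp split: split_indicator)
  finally show ?thesis .
qed

lemma summable_on_iff_nn_integral_abs:
  fixes f :: "'b \<Rightarrow> real"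
  shows "f summable_on UNIV \<longleftrightarrow> (\<integral>\<^sup>+j. ennreal \<bar>f j\<bar> \<partial>count_space UNIV) < \<infinity>"
proof -
  have "f summable_on UNIV \<longleftrightarrow> (\<lambda>j. norm (f j)) summable_on UNIV"
    by (rule summable_on_iff_abs_summable_on_real)
  also have "\<dots> \<longleftrightarrow> Infinite_Set_Sum.abs_summable_on f UNIV"
    by (rule abs_summable_equivalent)
  also have "\<dots> \<longleftrightarrow> (\<integral>\<^sup>+j. ennreal \<bar>f j\<bar> \<partial>count_space UNIV) < \<infinity>"
    by (simp add: Infinite_Set_Sum.abs_summable_on_def integrable_iff_bounded)
  finally show ?thesis .
qed

text \<open>The passage from finite sums to an infinite one. The right-hand side is an extended
  nonnegative integral, so it may be infinite, and it can be integrated term by term in a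
  random parameter. This is why it replaces Minkowski's inequality in what follows.\<close>

lemma abs_powr_infsum_le:
  fixes a x :: "'b \<Rightarrow> real"
  assumes "p \<ge> 1" "(\<lambda>j. \<bar>a j\<bar>) summable_on UNIV" "((\<lambda>j. a j * x j) has_sum y) UNIV"
  shows "abs_powr p y \<le> ennreal ((\<Sum>\<^sub>\<infinity>j. \<bar>a j\<bar>) powr (p - 1)) *
           (\<integral>\<^sup>+j. ennreal \<bar>a j\<bar> * abs_powr p (x j) \<partial>count_space UNIV)" (is "_ \<le> ?R")
proof (rule tendsto_upperbound)
  show "((\<lambda>F. abs_powr p (\<Sum>j\<in>F. a j * x j)) \<longlongrightarrow> abs_powr p y) (finite_subsets_at_top UNIV)"
    using assms by (intro tendsto_abs_powr) (auto simp: has_sum_def)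
  show "\<forall>\<^sub>F F in finite_subsets_at_top UNIV. abs_powr p (\<Sum>j\<in>F. a j * x j) \<le> ?R"
  proof (rule eventually_finite_subsets_at_top_weakI)
    fix F :: "'b set" assume F: "finite F"
    have "abs_powr p (\<Sum>j\<in>F. a j * x j)
        \<le> ennreal ((\<Sum>j\<in>F. \<bar>a j\<bar>) powr (p - 1)) * (\<Sum>j\<in>F. ennreal \<bar>a j\<bar> * abs_powr p (x j))"
      using ennreal_leI [OF powr_weighted_sum_le [OF F assms(1)]]
      by (simp add: abs_powr_def ennreal_mult sum_nonneg flip: sum_ennreal)
    also have "\<dots> \<le> ?R"
      using assms F
      by (intro mult_mono ennreal_leI powr_mono2 sum_nonneg finite_sum_le_infsum
          sum_le_nn_integral_count_space) auto
    finally show "abs_powr p (\<Sum>j\<in>F. a j * x j) \<le> ?R" .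
  qed
qed auto

section \<open>Deviation of a step path from a continuous path\<close>

text \<open>The supremum runs over rational times only, so that it is measurable when \<open>s\<close> and \<open>v\<close> are
  random. For continuous \<open>v\<close> it equals the supremum over the whole unit interval, see
  \<open>SUP_unit_interval_eq_deviation\<close> below.\<close>

definition deviation :: "real \<Rightarrow> nat \<Rightarrow> (nat \<Rightarrow> real) \<Rightarrow> (real \<Rightarrow> real) \<Rightarrow> ennreal" where
  "deviation p n s v = (SUP t\<in>\<rat> \<inter> {0..1}. abs_powr p (s (nat \<lfloor>real n * t\<rfloor>) - v t))"

lemma nat_floor_mult_le:
  fixes t :: real
  assumes "t \<in> {0..1}"
  shows "nat \<lfloor>real n * t\<rfloor> \<le> n"
proof -
  have "real n * t \<le> real n * 1" using assms by (intro mult_left_mono) auto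
  then have "\<lfloor>real n * t\<rfloor> \<le> int n" by linarith
  then show ?thesis by simp
qed

lemma deviation_upper:
  "t \<in> \<rat> \<inter> {0..1} \<Longrightarrow> abs_powr p (s (nat \<lfloor>real n * t\<rfloor>) - v t) \<le> deviation p n s v"
  unfolding deviation_def by (rule SUP_upper)

lemma deviation_le:
  assumes "\<And>t. t \<in> \<rat> \<inter> {0..1} \<Longrightarrow> abs_powr p (s (nat \<lfloor>real n * t\<rfloor>) - v t) \<le> C"
  shows "deviation p n s v \<le> C"
  unfolding deviation_def using assms by (rule SUP_least)

lemma borel_measurable_deviation [measurable (raw)]:
  assumes [measurable]: "\<And>k. s k \<in> borel_measurable M"
    and v: "\<And>t. t \<in> {0..1} \<Longrightarrow> v t \<in> borel_measurable M"
  shows "(\<lambda>\<omega>. deviation p n (\<lambda>k. s k \<omega>) (\<lambda>t. v t \<omega>)) \<in> borel_measurable M"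
  unfolding deviation_def
proof (rule borel_measurable_SUP)
  show "countable (\<rat> \<inter> {0..1::real})" by (simp add: countable_rat)
  fix t :: real assume "t \<in> \<rat> \<inter> {0..1}"
  then have [measurable]: "v t \<in> borel_measurable M" using v by simp
  show "(\<lambda>\<omega>. abs_powr p (s (nat \<lfloor>real n * t\<rfloor>) \<omega> - v t \<omega>)) \<in> borel_measurable M"
    by measurable
qed

lemma deviation_change_path:
  assumes "p \<ge> 0"
  shows "deviation p n s' v
    \<le> ennreal (2 powr p) * (deviation p n s v + (SUP k\<in>{..n}. abs_powr p (s' k - s k)))"
proof (rule deviation_le)
  fix t :: real assume t: "t \<in> \<rat> \<inter> {0..1}"
  let ?k = "nat \<lfloor>real n * t\<rfloor>"
  have "abs_powr p (s' ?k - v t) \<le> ennreal (2 powr p) * (abs_powr p (s ?k - v t) + abs_powr p (s' ?k - s ?k))"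
    using abs_powr_add_le [OF assms, of "s ?k - v t" "s' ?k - s ?k"] by simp
  also have "\<dots> \<le> ennreal (2 powr p) * (deviation p n s v + (SUP k\<in>{..n}. abs_powr p (s' k - s k)))"
    using t nat_floor_mult_le [of t n] by (intro mult_left_mono add_mono deviation_upper SUP_upper) auto
  finally show "abs_powr p (s' ?k - v t) \<le> \<dots>" .
qed

lemma limit_path_le:
  assumes "p \<ge> 0"
  shows "(SUP t\<in>\<rat> \<inter> {0..1}. abs_powr p (v t))
    \<le> ennreal (2 powr p) * (deviation p n s v + (SUP k\<in>{..n}. abs_powr p (s k)))"
  using deviation_change_path [OF assms, of n "\<lambda>_. 0" v s] by (simp add: deviation_def)

lemma deviation_le_paths:
  assumes "p \<ge> 0"
  shows "deviation p n s v
    \<le> ennreal (2 powr p) * ((SUP t\<in>\<rat> \<inter> {0..1}. abs_powr p (v t)) + (SUP k\<in>{..n}. abs_powr p (s k)))"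
  using deviation_change_path [OF assms, of n s v "\<lambda>_. 0"] by (simp add: deviation_def)

text \<open>Every value \<open>s k\<close> with \<open>k \<le> n\<close> is attained by the step path at the rational time \<open>k / n\<close>.\<close>

lemma step_path_le:
  assumes "p \<ge> 0" "n \<ge> 1"
  shows "(SUP k\<in>{..n}. abs_powr p (s k))
    \<le> ennreal (2 powr p) * (deviation p n s v + (SUP t\<in>\<rat> \<inter> {0..1}. abs_powr p (v t)))"
proof (rule SUP_least)
  fix k assume k: "k \<in> {..n}"
  define t where "t = real k / real n"
  have t: "t \<in> \<rat> \<inter> {0..1}" "nat \<lfloor>real n * t\<rfloor> = k"
    using k assms by (auto simp: t_def divide_simps)
  have "abs_powr p (s k) \<le> ennreal (2 powr p) * (abs_powr p (s k - v t) + abs_powr p (v t))"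
    using abs_powr_add_le [OF assms(1), of "s k - v t" "v t"] by simp
  also have "\<dots> \<le> ennreal (2 powr p) * (deviation p n s v + (SUP t\<in>\<rat> \<inter> {0..1}. abs_powr p (v t)))"
    using t deviation_upper [OF t(1), where p = p and n = n and s = s and v = v]
    by (intro mult_left_mono add_mono SUP_upper) auto
  finally show "abs_powr p (s k) \<le> \<dots>" .
qed

text \<open>A continuous path cannot follow a jump. At \<open>t = k / n\<close> the step path has the value \<open>s k\<close> and the
  left limit \<open>s (k - 1)\<close>, and \<open>v\<close> takes the same value \<open>v t\<close> from both sides; so at \<open>t\<close> or just
  before it the two paths are apart by at least half of the jump.\<close>

lemma jump_le_deviation:
  assumes "p > 0" "continuous_on {0..1} v" "k \<in> {1..n}"
  shows "abs_powr p (s k - s (k - 1)) \<le> ennreal (2 powr p) * (deviation p n s v + deviation p n s v)"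
proof -
  define t where "t = real k / real n"
  \<comment> \<open>Rational times that increase to \<open>t\<close> and stay in the interval where the step path is \<open>s (k - 1)\<close>.\<close>
  define u where "u i = (real k - 1 / real (i + 2)) / real n" for i
  have n: "n \<ge> 1" and k: "k \<ge> 1" "k \<le> n" using assms by auto
  have t: "t \<in> \<rat> \<inter> {0..1}" "nat \<lfloor>real n * t\<rfloor> = k"
    using k n by (auto simp: t_def divide_simps)
  have frac: "0 < 1 / real (i + 2)" "1 / real (i + 2) < 1" for i by auto
  have u: "u i \<in> \<rat> \<inter> {0..1}" for i
  proof -
    have "real k - 1 / real (i + 2) \<ge> 0" "real k - 1 / real (i + 2) \<le> real n"
      using frac [of i] k by linarith+
    moreover have "u i \<in> \<rat>" unfolding u_def by (intro Rats_divide Rats_diff) auto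
    moreover have "0 \<le> u i" "u i \<le> 1"
      unfolding u_def using calculation(1,2) n
      by (auto intro!: divide_nonneg_nonneg simp: divide_le_eq_1 simp del: diff_ge_0_iff_ge)
    ultimately show ?thesis by simp
  qed
  have fl: "nat \<lfloor>real n * u i\<rfloor> = k - 1" for i
  proof -
    have "real n * u i = real k - 1 / real (i + 2)" using n by (simp add: u_def)
    moreover have "\<lfloor>real k - 1 / real (i + 2)\<rfloor> = int k - 1"
      using frac [of i] by (simp add: floor_eq_iff)
    ultimately show ?thesis using k by simp
  qed
  have "(\<lambda>i. 1 / real (i + 2)) \<longlonglongrightarrow> 0"
    using LIMSEQ_ignore_initial_segment [OF lim_1_over_n, of 2] by simp
  then have "u \<longlonglongrightarrow> (real k - 0) / real n"
    unfolding u_def by (intro tendsto_intros) (use n in auto)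
  then have "u \<longlonglongrightarrow> t" by (simp add: t_def)
  then have "(\<lambda>i. v (u i)) \<longlonglongrightarrow> v t"
    using t u by (intro continuous_on_tendsto_compose [OF assms(2)]) auto
  then have "(\<lambda>i. abs_powr p (s (k - 1) - v (u i))) \<longlonglongrightarrow> abs_powr p (s (k - 1) - v t)"
    using assms by (intro tendsto_abs_powr tendsto_intros) auto
  then have left: "abs_powr p (s (k - 1) - v t) \<le> deviation p n s v"
    using deviation_upper [OF u, where p = p and n = n and s = s and v = v]
    by (intro LIMSEQ_le_const2) (auto simp: fl)
  have "abs_powr p (s k - s (k - 1))
      \<le> ennreal (2 powr p) * (abs_powr p (s k - v t) + abs_powr p (s (k - 1) - v t))"
    using abs_powr_diff_le [of p "s k - v t" "s (k - 1) - v t"] assms by simp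
  also have "\<dots> \<le> ennreal (2 powr p) * (deviation p n s v + deviation p n s v)"
    using left deviation_upper [OF t(1), where p = p and n = n and s = s and v = v] t
    by (intro mult_left_mono add_mono) auto
  finally show ?thesis .
qed

text \<open>The step path is right-continuous, so the difference at a time \<open>t < 1\<close> is a limit of
  differences at rational times that decrease to \<open>t\<close>; the remaining time \<open>1\<close> is itself rational.\<close>

lemma SUP_unit_interval_eq_deviation:
  assumes "p > 0" "continuous_on {0..1} v"
  shows "(SUP t\<in>{0..1}. abs_powr p (s (nat \<lfloor>real n * t\<rfloor>) - v t)) = deviation p n s v"
    (is "(SUP t\<in>_. ?f t) = _")
proof (rule antisym)
  show "deviation p n s v \<le> (SUP t\<in>{0..1}. ?f t)"
    by (intro deviation_le SUP_upper) auto
  show "(SUP t\<in>{0..1}. ?f t) \<le> deviation p n s v"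
  proof (rule SUP_least)
    fix t :: real assume t: "t \<in> {0..1}"
    show "?f t \<le> deviation p n s v"
    proof (cases "t = 1")
      case True
      then show ?thesis using deviation_upper [where t = 1 and p = p and n = n and s = s and v = v] by simp
    next
      case False
      \<comment> \<open>Between \<open>t\<close> and \<open>t + d\<close> the step path does not jump; the summand \<open>1\<close> in the denominator
        covers the case \<open>n = 0\<close> and makes the estimate strict.\<close>
      define d where "d = (real_of_int \<lfloor>real n * t\<rfloor> + 1 - real n * t) / (real n + 1)"
      have d: "d > 0" unfolding d_def by (intro divide_pos_pos) linarith+
      have "\<exists>q\<in>\<rat>. t < q \<and> q < t + min (1 - t) (d / (real i + 1))" for i
        using t False d by (intro Rats_dense_in_real) auto
      then obtain u where u: "\<And>i. u i \<in> \<rat>" "\<And>i. t < u i" "\<And>i. u i < t + min (1 - t) (d / (real i + 1))"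
        by metis
      have ui: "u i \<in> \<rat> \<inter> {0..1}" for i
        using u(1-3) [of i] t by (auto simp: min_def split: if_splits)
      have fl: "\<lfloor>real n * u i\<rfloor> = \<lfloor>real n * t\<rfloor>" for i
      proof -
        have "u i < t + d / (real i + 1)" using u(3) [of i] by simp
        also have "d / (real i + 1) \<le> d / 1" using d by (intro divide_left_mono) auto
        finally have "u i - t \<le> d" by simp
        then have "real n * (u i - t) \<le> real n * d" by (intro mult_left_mono) auto
        also have "\<dots> < (real n + 1) * d" using d by (intro mult_strict_right_mono) auto
        also have "\<dots> = real_of_int \<lfloor>real n * t\<rfloor> + 1 - real n * t" by (simp add: d_def)
        finally have "real n * u i < real_of_int \<lfloor>real n * t\<rfloor> + 1" by (simp add: algebra_simps)
        moreover have "real n * t \<le> real n * u i" using u(2) [of i] by (intro mult_left_mono) auto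
        ultimately show ?thesis by linarith
      qed
      have "(\<lambda>i. d / (real i + 1)) \<longlonglongrightarrow> 0"
        using tendsto_mult [OF tendsto_const [of d] LIMSEQ_inverse_real_of_nat]
        by (simp add: divide_inverse add.commute)
      then have lim: "(\<lambda>i. t + d / (real i + 1)) \<longlonglongrightarrow> t"
        using tendsto_add [OF tendsto_const [of t]] by fastforce
      have "u \<longlonglongrightarrow> t"
      proof (rule tendsto_sandwich [OF _ _ tendsto_const lim])
        show "\<forall>\<^sub>F i in sequentially. t \<le> u i"
          using u(2) by (simp add: less_imp_le)
        have "u i \<le> t + d / (real i + 1)" for i
          using u(3) [of i] by simp
        then show "\<forall>\<^sub>F i in sequentially. u i \<le> t + d / (real i + 1)"
          by simp
      qed
      then have "(\<lambda>i. v (u i)) \<longlonglongrightarrow> v t"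
        using t ui by (intro continuous_on_tendsto_compose [OF assms(2)]) auto
      then have "(\<lambda>i. abs_powr p (s (nat \<lfloor>real n * t\<rfloor>) - v (u i))) \<longlonglongrightarrow> ?f t"
        using assms by (intro tendsto_abs_powr tendsto_intros) auto
      then show ?thesis
        using deviation_upper [OF ui, where p = p and n = n and s = s and v = v]
    by (intro LIMSEQ_le_const2) (auto simp: fl)
    qed
  qed
qed

text \<open>The difference between the combined paths is \<open>\<Sum>j. a j * (s j k - v t)\<close>, because the same
  limit path \<open>v\<close> is compared with each of the paths \<open>s j\<close>.\<close>

lemma deviation_linear_combination_le:
  fixes a :: "'b \<Rightarrow> real"
  assumes p: "p \<ge> 1" and a: "(\<lambda>j. \<bar>a j\<bar>) summable_on UNIV"
    and S: "\<And>k. ((\<lambda>j. a j * s j k) has_sum S k) UNIV"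
  shows "deviation p n S (\<lambda>t. (\<Sum>\<^sub>\<infinity>j. a j) * v t)
    \<le> ennreal ((\<Sum>\<^sub>\<infinity>j. \<bar>a j\<bar>) powr (p - 1)) *
        (\<integral>\<^sup>+j. ennreal \<bar>a j\<bar> * deviation p n (s j) v \<partial>count_space UNIV)"
proof (rule deviation_le)
  fix t :: real assume t: "t \<in> \<rat> \<inter> {0..1}"
  let ?k = "nat \<lfloor>real n * t\<rfloor>"
  have "a summable_on UNIV"
    using a by (simp add: abs_summable_summable)
  then have "((\<lambda>j. a j * v t) has_sum (\<Sum>\<^sub>\<infinity>j. a j) * v t) UNIV"
    by (intro has_sum_cmult_left has_sum_infsum)
  then have "((\<lambda>j. a j * s j ?k + - (a j * v t)) has_sum S ?k + - ((\<Sum>\<^sub>\<infinity>j. a j) * v t)) UNIV"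
    by (intro has_sum_add has_sum_uminusI S)
  then have "((\<lambda>j. a j * (s j ?k - v t)) has_sum S ?k - (\<Sum>\<^sub>\<infinity>j. a j) * v t) UNIV"
    by (simp add: right_diff_distrib)
  from abs_powr_infsum_le [OF p a this]
  have "abs_powr p (S ?k - (\<Sum>\<^sub>\<infinity>j. a j) * v t) \<le> ennreal ((\<Sum>\<^sub>\<infinity>j. \<bar>a j\<bar>) powr (p - 1)) *
        (\<integral>\<^sup>+j. ennreal \<bar>a j\<bar> * abs_powr p (s j ?k - v t) \<partial>count_space UNIV)" .
  also have "\<dots> \<le> ennreal ((\<Sum>\<^sub>\<infinity>j. \<bar>a j\<bar>) powr (p - 1)) *
        (\<integral>\<^sup>+j. ennreal \<bar>a j\<bar> * deviation p n (s j) v \<partial>count_space UNIV)"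
    using t by (intro mult_left_mono nn_integral_mono deviation_upper) auto
  finally show "abs_powr p (S ?k - (\<Sum>\<^sub>\<infinity>j. a j) * v t) \<le> \<dots>" .
qed

section \<open>Stationary sequences\<close>

lemma stationary_sequence_measurable:
  "stationary_sequence M \<xi> \<Longrightarrow> \<xi> i \<in> borel_measurable M"
  by (simp add: stationary_sequence_def)

lemma stationary_nn_integral_shift:
  assumes "stationary_sequence M \<xi>"
    and F [measurable]: "F \<in> borel_measurable (\<Pi>\<^sub>M i\<in>UNIV. borel)"
  shows "(\<integral>\<^sup>+\<omega>. F (\<lambda>i. \<xi> (i + h) \<omega>) \<partial>M) = (\<integral>\<^sup>+\<omega>. F (\<lambda>i. \<xi> i \<omega>) \<partial>M)"
proof -
  have meas: "(\<lambda>\<omega> i. \<xi> (i + h) \<omega>) \<in> measurable M (\<Pi>\<^sub>M i\<in>UNIV. borel)" for h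
    using stationary_sequence_measurable [OF assms(1)] by (intro measurable_abs_UNIV) auto
  have "distr M (\<Pi>\<^sub>M i\<in>UNIV. borel) (\<lambda>\<omega> i. \<xi> (i + h) \<omega>) =
      distr M (\<Pi>\<^sub>M i\<in>UNIV. borel) (\<lambda>\<omega> i. \<xi> i \<omega>)"
    using assms by (auto simp: stationary_sequence_def)
  then have "(\<integral>\<^sup>+x. F x \<partial>distr M (\<Pi>\<^sub>M i\<in>UNIV. borel) (\<lambda>\<omega> i. \<xi> (i + h) \<omega>)) =
      (\<integral>\<^sup>+x. F x \<partial>distr M (\<Pi>\<^sub>M i\<in>UNIV. borel) (\<lambda>\<omega> i. \<xi> i \<omega>))"
    by (rule arg_cong)
  then show ?thesis
    using meas [of h] meas [of 0] by (simp add: nn_integral_distr)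
qed

lemma measurable_partial_sum [measurable (raw)]:
  assumes [measurable]: "\<And>i. Y i \<in> borel_measurable M"
  shows "partial_sum Y k \<in> borel_measurable M"
  unfolding partial_sum_def [abs_def] by measurable

lemma borel_measurable_nn_integral_count_space:
  fixes f :: "'i :: countable \<Rightarrow> 'a \<Rightarrow> ennreal"
  assumes [measurable]: "\<And>i. f i \<in> borel_measurable M"
  shows "(\<lambda>\<omega>. \<integral>\<^sup>+i. f i \<omega> \<partial>count_space UNIV) \<in> borel_measurable M"
proof (rule sigma_finite_measure.borel_measurable_nn_integral)
  show "sigma_finite_measure (count_space (UNIV :: 'i set))"
    by (intro sigma_finite_measure_count_space_countable countableI_type)
  have "(\<lambda>x. f (snd x) (fst x)) \<in> borel_measurable (M \<Otimes>\<^sub>M count_space UNIV)"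
    by (rule measurable_compose_countable' [where I = UNIV and f = "\<lambda>i x. f i (fst x)"]) auto
  then show "(\<lambda>(\<omega>, i). f i \<omega>) \<in> borel_measurable (M \<Otimes>\<^sub>M count_space UNIV)"
    by (simp add: case_prod_beta')
qed

lemma partial_sum_linear_process_has_sum:
  assumes "\<And>k. (\<lambda>j. a j * \<xi> (k - j) \<omega>) summable_on UNIV"
  shows "((\<lambda>j. a j * partial_sum (\<lambda>i. \<xi> (i + - j)) k \<omega>) has_sum
           partial_sum (linear_process a \<xi>) k \<omega>) UNIV"
proof (induction k)
  case (Suc k)
  have "((\<lambda>j. a j * \<xi> (int (Suc k) - j) \<omega>) has_sum linear_process a \<xi> (int (Suc k)) \<omega>) UNIV"
    unfolding linear_process_def using assms by (rule has_sum_infsum)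
  from has_sum_add [OF Suc this] show ?case
    by (simp add: partial_sum_def algebra_simps)
qed (simp add: partial_sum_def)

text \<open>Stationarity gives all \<open>\<xi> i\<close> the same first absolute moment, so \<open>\<Sum>j. \<bar>a j * \<xi> (k - j)\<bar>\<close> has
  finite expectation and hence is finite almost surely.\<close>

lemma AE_linear_process_summable:
  assumes "stationary_sequence M \<xi>" "integrable M (\<xi> 0)"
    and a: "(\<lambda>j. \<bar>a j\<bar>) summable_on UNIV"
  shows "AE \<omega> in M. \<forall>k. (\<lambda>j. a j * \<xi> (k - j) \<omega>) summable_on UNIV"
proof -
  note [measurable] = stationary_sequence_measurable [OF assms(1)]
  define E where "E = (\<integral>\<^sup>+\<omega>. ennreal \<bar>\<xi> 0 \<omega>\<bar> \<partial>M)"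
  have E: "E < \<infinity>"
    using assms(2) by (simp add: E_def integrable_iff_bounded)
  have same_mean: "(\<integral>\<^sup>+\<omega>. ennreal \<bar>\<xi> i \<omega>\<bar> \<partial>M) = E" for i
  proof -
    have "(\<lambda>x. ennreal \<bar>x 0\<bar>) \<in> borel_measurable (\<Pi>\<^sub>M i\<in>(UNIV :: int set). borel)"
      by measurable
    from stationary_nn_integral_shift [OF assms(1) this, of i] show ?thesis
      by (simp add: E_def)
  qed
  have "AE \<omega> in M. (\<lambda>j. a j * \<xi> (k - j) \<omega>) summable_on UNIV" for k
  proof -
    have "(\<integral>\<^sup>+\<omega>. (\<integral>\<^sup>+j. ennreal \<bar>a j * \<xi> (k - j) \<omega>\<bar> \<partial>count_space UNIV) \<partial>M)
        = (\<integral>\<^sup>+j. (\<integral>\<^sup>+\<omega>. ennreal \<bar>a j * \<xi> (k - j) \<omega>\<bar> \<partial>M) \<partial>count_space UNIV)"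
      by (rule nn_integral_count_space_nn_integral) auto
    also have "\<dots> = (\<integral>\<^sup>+j. ennreal \<bar>a j\<bar> * E \<partial>count_space UNIV)"
      by (simp add: abs_mult ennreal_mult nn_integral_cmult same_mean)
    also have "\<dots> = (\<integral>\<^sup>+j. ennreal \<bar>a j\<bar> \<partial>count_space UNIV) * E"
      by (simp add: nn_integral_multc)
    also have "\<dots> < \<infinity>"
      using a E summable_on_iff_nn_integral_abs [of "\<lambda>j. \<bar>a j\<bar>"]
      by (simp add: ennreal_mult_less_top)
    finally have fin: "(\<integral>\<^sup>+\<omega>. (\<integral>\<^sup>+j. ennreal \<bar>a j * \<xi> (k - j) \<omega>\<bar> \<partial>count_space UNIV) \<partial>M) \<noteq> \<infinity>"
      by simp
    have "(\<lambda>\<omega>. \<integral>\<^sup>+j. ennreal \<bar>a j * \<xi> (k - j) \<omega>\<bar> \<partial>count_space UNIV) \<in> borel_measurable M"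
      by (intro borel_measurable_nn_integral_count_space) measurable
    from nn_integral_PInf_AE [OF this fin] show ?thesis
      by (simp add: summable_on_iff_nn_integral_abs top.not_eq_extremum)
  qed
  then show ?thesis by (simp add: AE_all_countable)
qed

section \<open>Functional limits and time shifts\<close>

lemma tendsto_zero_ennreal_majorant:
  fixes f g :: "nat \<Rightarrow> ennreal"
  assumes "g \<longlonglongrightarrow> 0" "\<And>n. n \<ge> N \<Longrightarrow> f n \<le> g n"
  shows "f \<longlonglongrightarrow> 0"
proof (rule tendsto_sandwich [OF _ _ tendsto_const assms(1)])
  show "\<forall>\<^sub>F n in sequentially. f n \<le> g n"
    using assms(2) by (rule eventually_sequentiallyI)
qed simp

text \<open>The setting that the argument is about: the normalized partial sums of a stationary
  sequence converge, in the \<open>p\<close>-th mean of the uniform distance, to some process with continuous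
  paths. The limit \<open>V\<close> is arbitrary here; in the application it is \<open>\<eta> W\<close>.\<close>

locale stationary_functional_limit =
  fixes M :: "'a measure" and \<xi> :: "int \<Rightarrow> 'a \<Rightarrow> real" and b :: "nat \<Rightarrow> real"
    and p :: real and V :: "real \<Rightarrow> 'a \<Rightarrow> real"
  assumes stationary: "stationary_sequence M \<xi>"
    and p_ge_1: "p \<ge> 1"
    and b_pos: "\<And>n. n \<ge> 1 \<Longrightarrow> b n > 0"
    and V_measurable: "\<And>t. t \<in> {0..1} \<Longrightarrow> V t \<in> borel_measurable M"
    and V_continuous: "AE \<omega> in M. continuous_on {0..1} (\<lambda>t. V t \<omega>)"
    and limit: "(\<lambda>n. \<integral>\<^sup>+\<omega>. deviation p n (\<lambda>k. partial_sum \<xi> k \<omega> / b n) (\<lambda>t. V t \<omega>) \<partial>M)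
      \<longlonglongrightarrow> 0"
begin

lemma \<xi>_measurable [measurable]: "\<xi> i \<in> borel_measurable M"
  using stationary by (rule stationary_sequence_measurable)

lemma p_pos: "p > 0" "p \<ge> 0"
  using p_ge_1 by auto

definition shifted_deviation :: "nat \<Rightarrow> int \<Rightarrow> 'a \<Rightarrow> ennreal" where
  "shifted_deviation n h \<omega> =
     deviation p n (\<lambda>k. partial_sum (\<lambda>i. \<xi> (i + h)) k \<omega> / b n) (\<lambda>t. V t \<omega>)"

definition shifted_jump :: "nat \<Rightarrow> int \<Rightarrow> 'a \<Rightarrow> ennreal" where
  "shifted_jump n h \<omega> = (SUP k\<in>{1..n}. abs_powr p (\<xi> (int k + h) \<omega> / b n))"

definition shifted_max :: "nat \<Rightarrow> int \<Rightarrow> 'a \<Rightarrow> ennreal" where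
  "shifted_max n h \<omega> = (SUP k\<in>{..n}. abs_powr p (partial_sum (\<lambda>i. \<xi> (i + h)) k \<omega> / b n))"

definition limit_max :: "'a \<Rightarrow> ennreal" where
  "limit_max \<omega> = (SUP t\<in>\<rat> \<inter> {0..1}. abs_powr p (V t \<omega>))"

lemma shifted_deviation_measurable [measurable]: "shifted_deviation n h \<in> borel_measurable M"
  unfolding shifted_deviation_def [abs_def]
  by (rule borel_measurable_deviation) (use V_measurable in measurable)

lemma shifted_jump_measurable [measurable]: "shifted_jump n h \<in> borel_measurable M"
  unfolding shifted_jump_def [abs_def] by measurable

lemma shifted_max_measurable [measurable]: "shifted_max n h \<in> borel_measurable M"
  unfolding shifted_max_def [abs_def] by measurable

lemma limit_max_measurable [measurable]: "limit_max \<in> borel_measurable M"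
  unfolding limit_max_def [abs_def]
proof (rule borel_measurable_SUP)
  show "countable (\<rat> \<inter> {0..1::real})" by (simp add: countable_rat)
  fix t :: real assume "t \<in> \<rat> \<inter> {0..1}"
  then have [measurable]: "V t \<in> borel_measurable M" using V_measurable by simp
  show "(\<lambda>\<omega>. abs_powr p (V t \<omega>)) \<in> borel_measurable M" by measurable
qed

lemma limit_0: "(\<lambda>n. \<integral>\<^sup>+\<omega>. shifted_deviation n 0 \<omega> \<partial>M) \<longlonglongrightarrow> 0"
  using limit by (simp add: shifted_deviation_def)

lemma nn_integral_shifted_jump: "(\<integral>\<^sup>+\<omega>. shifted_jump n h \<omega> \<partial>M) = (\<integral>\<^sup>+\<omega>. shifted_jump n 0 \<omega> \<partial>M)"
proof -
  have "(\<lambda>x. SUP k\<in>{1..n}. abs_powr p (x (int k) / b n))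
      \<in> borel_measurable (\<Pi>\<^sub>M i\<in>(UNIV :: int set). borel)"
    by measurable
  from stationary_nn_integral_shift [OF stationary this, of h]
  show ?thesis by (simp add: shifted_jump_def)
qed

lemma nn_integral_shifted_max: "(\<integral>\<^sup>+\<omega>. shifted_max n h \<omega> \<partial>M) = (\<integral>\<^sup>+\<omega>. shifted_max n 0 \<omega> \<partial>M)"
proof -
  have "(\<lambda>x. SUP k\<in>{..n}. abs_powr p ((\<Sum>i=1..k. x (int i)) / b n))
      \<in> borel_measurable (\<Pi>\<^sub>M i\<in>(UNIV :: int set). borel)"
    by measurable
  from stationary_nn_integral_shift [OF stationary this, of h]
  show ?thesis by (simp add: shifted_max_def partial_sum_def)
qed

lemma shifted_jump_le: "AE \<omega> in M. shifted_jump n 0 \<omega>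
    \<le> ennreal (2 powr p) * (shifted_deviation n 0 \<omega> + shifted_deviation n 0 \<omega>)"
  using V_continuous
proof eventually_elim
  case (elim \<omega>)
  show ?case unfolding shifted_jump_def
  proof (rule SUP_least)
    fix k assume k: "k \<in> {1..n}"
    have "partial_sum \<xi> k \<omega> = partial_sum \<xi> (k - 1) \<omega> + \<xi> (int k) \<omega>"
      using k by (cases k) (auto simp: partial_sum_def)
    then have "\<xi> (int k + 0) \<omega> / b n = partial_sum \<xi> k \<omega> / b n - partial_sum \<xi> (k - 1) \<omega> / b n"
      by (simp add: add_divide_distrib)
    then show "abs_powr p (\<xi> (int k + 0) \<omega> / b n)
        \<le> ennreal (2 powr p) * (shifted_deviation n 0 \<omega> + shifted_deviation n 0 \<omega>)"
      using jump_le_deviation [OF p_pos(1) elim k, of "\<lambda>k. partial_sum \<xi> k \<omega> / b n"]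
      by (simp add: shifted_deviation_def)
  qed
qed

text \<open>This estimate is the reason why the innovations lie in \<open>L\<^sup>p\<close>, and why the largest of the
  first \<open>n\<close> of them is negligible compared with \<open>b n\<close>.\<close>

lemma nn_integral_shifted_jump_le: "(\<integral>\<^sup>+\<omega>. shifted_jump n h \<omega> \<partial>M)
    \<le> ennreal (2 powr p) * ((\<integral>\<^sup>+\<omega>. shifted_deviation n 0 \<omega> \<partial>M) + (\<integral>\<^sup>+\<omega>. shifted_deviation n 0 \<omega> \<partial>M))"
  using nn_integral_mono_AE [OF shifted_jump_le, of n]
  by (simp add: nn_integral_shifted_jump [of n h] nn_integral_cmult nn_integral_add)

lemma nn_integral_shifted_jump_tendsto: "(\<lambda>n. \<integral>\<^sup>+\<omega>. shifted_jump n h \<omega> \<partial>M) \<longlonglongrightarrow> 0"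
proof (rule tendsto_zero_ennreal_majorant [OF _ nn_integral_shifted_jump_le])
  let ?D = "\<lambda>n. \<integral>\<^sup>+\<omega>. shifted_deviation n 0 \<omega> \<partial>M"
  have "(\<lambda>n. ennreal (2 powr p) * (?D n + ?D n)) \<longlonglongrightarrow> ennreal (2 powr p) * (0 + 0)"
    by (intro ennreal_tendsto_cmult tendsto_add limit_0) simp
  then show "(\<lambda>n. ennreal (2 powr p) * (?D n + ?D n)) \<longlonglongrightarrow> 0"
    by simp
qed

text \<open>Moving the window of summation by one step adds one innovation and removes another.\<close>

lemma partial_sum_shift_Suc:
  "partial_sum (\<lambda>i. \<xi> (i + (h + 1))) k \<omega> - partial_sum (\<lambda>i. \<xi> (i + h)) k \<omega>
    = \<xi> (int k + (h + 1)) \<omega> - \<xi> (1 + h) \<omega>"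
  by (induction k) (auto simp: partial_sum_def algebra_simps)

lemma shift_increment_le:
  assumes "n \<ge> 1"
  shows "(SUP k\<in>{..n}. abs_powr p (partial_sum (\<lambda>i. \<xi> (i + (h + 1))) k \<omega> / b n
            - partial_sum (\<lambda>i. \<xi> (i + h)) k \<omega> / b n))
    \<le> ennreal (2 powr p) * (shifted_jump n (h + 1) \<omega> + shifted_jump n h \<omega>)"
proof (rule SUP_least)
  fix k assume k: "k \<in> {..n}"
  show "abs_powr p (partial_sum (\<lambda>i. \<xi> (i + (h + 1))) k \<omega> / b n
            - partial_sum (\<lambda>i. \<xi> (i + h)) k \<omega> / b n)
    \<le> ennreal (2 powr p) * (shifted_jump n (h + 1) \<omega> + shifted_jump n h \<omega>)" (is "?L \<le> ?R")
  proof (cases "k = 0")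
    case False
    have "?L = abs_powr p (\<xi> (int k + (h + 1)) \<omega> / b n - \<xi> (1 + h) \<omega> / b n)"
      by (simp only: partial_sum_shift_Suc flip: diff_divide_distrib)
    also have "\<dots> \<le> ennreal (2 powr p) *
        (abs_powr p (\<xi> (int k + (h + 1)) \<omega> / b n) + abs_powr p (\<xi> (1 + h) \<omega> / b n))"
      by (rule abs_powr_diff_le [OF p_pos(2)])
    also have "\<dots> \<le> ?R"
    proof (intro mult_left_mono add_mono)
      show "abs_powr p (\<xi> (int k + (h + 1)) \<omega> / b n) \<le> shifted_jump n (h + 1) \<omega>"
        unfolding shifted_jump_def using k False by (intro SUP_upper) auto
      have "abs_powr p (\<xi> (int 1 + h) \<omega> / b n) \<le> shifted_jump n h \<omega>"
        unfolding shifted_jump_def using assms by (intro SUP_upper) auto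
      then show "abs_powr p (\<xi> (1 + h) \<omega> / b n) \<le> shifted_jump n h \<omega>" by simp
    qed simp
    finally show ?thesis .
  qed (simp add: partial_sum_def)
qed

text \<open>Common to the two directions of the induction over the shift: \<open>h'\<close> stands for \<open>h + 1\<close> or
  \<open>h - 1\<close>, and \<open>i\<close> and \<open>j\<close> for the two shifts whose jumps appear.\<close>

lemma adjacent_shift_tendsto:
  assumes "(\<lambda>n. \<integral>\<^sup>+\<omega>. shifted_deviation n h \<omega> \<partial>M) \<longlonglongrightarrow> 0"
    and "\<And>n \<omega>. n \<ge> 1 \<Longrightarrow> shifted_deviation n h' \<omega> \<le> ennreal (2 powr p) * (shifted_deviation n h \<omega>
            + ennreal (2 powr p) * (shifted_jump n i \<omega> + shifted_jump n j \<omega>))"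
  shows "(\<lambda>n. \<integral>\<^sup>+\<omega>. shifted_deviation n h' \<omega> \<partial>M) \<longlonglongrightarrow> 0"
proof -
  let ?g = "\<lambda>n. ennreal (2 powr p) * ((\<integral>\<^sup>+\<omega>. shifted_deviation n h \<omega> \<partial>M)
    + ennreal (2 powr p) * ((\<integral>\<^sup>+\<omega>. shifted_jump n i \<omega> \<partial>M) + (\<integral>\<^sup>+\<omega>. shifted_jump n j \<omega> \<partial>M)))"
  have "?g \<longlonglongrightarrow> ennreal (2 powr p) * (0 + ennreal (2 powr p) * (0 + 0))"
    by (intro ennreal_tendsto_cmult tendsto_add assms nn_integral_shifted_jump_tendsto) auto
  then have "?g \<longlonglongrightarrow> 0" by simp
  then show ?thesis
  proof (rule tendsto_zero_ennreal_majorant)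
    fix n :: nat assume "n \<ge> 1"
    then have "(\<integral>\<^sup>+\<omega>. shifted_deviation n h' \<omega> \<partial>M) \<le> (\<integral>\<^sup>+\<omega>. ennreal (2 powr p) * (shifted_deviation n h \<omega>
            + ennreal (2 powr p) * (shifted_jump n i \<omega> + shifted_jump n j \<omega>)) \<partial>M)"
      using assms(2) by (intro nn_integral_mono)
    then show "(\<integral>\<^sup>+\<omega>. shifted_deviation n h' \<omega> \<partial>M) \<le> ?g n"
      by (simp add: nn_integral_cmult nn_integral_add)
  qed
qed

text \<open>The shifted sequence is compared with the same path \<open>V\<close> as the original one. Stationarity
  alone does not give this, since it concerns laws and not the joint behaviour with \<open>V\<close>; it holds
  because a shift changes each partial sum by two boundary terms, which are single innovations.\<close>

lemma shifted_deviation_tendsto: "(\<lambda>n. \<integral>\<^sup>+\<omega>. shifted_deviation n h \<omega> \<partial>M) \<longlonglongrightarrow> 0"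
proof (induction h rule: int_induct [where k = 0])
  case base
  show ?case by (rule limit_0)
next
  case (step1 h)
  show ?case
  proof (rule adjacent_shift_tendsto [OF step1(2)])
    fix n \<omega> assume n: "n \<ge> (1::nat)"
    show "shifted_deviation n (h + 1) \<omega> \<le> ennreal (2 powr p) * (shifted_deviation n h \<omega>
        + ennreal (2 powr p) * (shifted_jump n (h + 1) \<omega> + shifted_jump n h \<omega>))"
      unfolding shifted_deviation_def
      by (intro order_trans [OF deviation_change_path [OF p_pos(2),
            where s = "\<lambda>k. partial_sum (\<lambda>i. \<xi> (i + h)) k \<omega> / b n"]]
          mult_left_mono add_mono order_refl shift_increment_le n) simp
  qed
next
  case (step2 h)
  show ?case
  proof (rule adjacent_shift_tendsto [OF step2(2)])
    fix n \<omega> assume n: "n \<ge> (1::nat)"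
    have "(SUP k\<in>{..n}. abs_powr p (partial_sum (\<lambda>i. \<xi> (i + (h - 1))) k \<omega> / b n
            - partial_sum (\<lambda>i. \<xi> (i + h)) k \<omega> / b n))
        \<le> ennreal (2 powr p) * (shifted_jump n h \<omega> + shifted_jump n (h - 1) \<omega>)"
      using shift_increment_le [OF n, of "h - 1" \<omega>]
      by (subst abs_powr_minus_commute) simp
    then show "shifted_deviation n (h - 1) \<omega> \<le> ennreal (2 powr p) * (shifted_deviation n h \<omega>
        + ennreal (2 powr p) * (shifted_jump n h \<omega> + shifted_jump n (h - 1) \<omega>))"
      unfolding shifted_deviation_def
      by (intro order_trans [OF deviation_change_path [OF p_pos(2),
            where s = "\<lambda>k. partial_sum (\<lambda>i. \<xi> (i + h)) k \<omega> / b n"]]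
          mult_left_mono add_mono order_refl) simp_all
  qed
qed

text \<open>The bound is uniform in the shift because the deviation is at most a multiple of
  \<open>limit_max\<close>, which does not depend on the shift, plus \<open>shifted_max\<close>, whose integral does not
  depend on it by stationarity. The two integrals control each other through the unshifted
  deviation: at one large \<open>N\<close> the partial sums are in \<open>L\<^sup>p\<close>, hence so is the supremum of \<open>V\<close>, and
  this in turn bounds \<open>shifted_max n 0\<close> for all \<open>n \<ge> N\<close>.\<close>

lemma shifted_deviation_bounded:
  obtains K N where "K < \<top>" "\<And>n h. n \<ge> N \<Longrightarrow> (\<integral>\<^sup>+\<omega>. shifted_deviation n h \<omega> \<partial>M) \<le> K"
proof -
  let ?c = "ennreal (2 powr p)"
  have "\<forall>\<^sub>F n in sequentially. (\<integral>\<^sup>+\<omega>. shifted_deviation n 0 \<omega> \<partial>M) < 1"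
    using limit_0 by (rule order_tendstoD) simp
  then obtain N0 where N0: "\<And>n. n \<ge> N0 \<Longrightarrow> (\<integral>\<^sup>+\<omega>. shifted_deviation n 0 \<omega> \<partial>M) < 1"
    by (auto simp: eventually_sequentially)
  define N where "N = max 1 N0"
  have N: "N \<ge> 1" "\<And>n. n \<ge> N \<Longrightarrow> (\<integral>\<^sup>+\<omega>. shifted_deviation n 0 \<omega> \<partial>M) \<le> 1"
    using N0 by (auto simp: N_def less_imp_le)
  have "(\<integral>\<^sup>+\<omega>. shifted_jump N 0 \<omega> \<partial>M) \<le> ?c * (1 + 1)"
    by (rule order_trans [OF nn_integral_shifted_jump_le]) (intro mult_left_mono add_mono N order_refl zero_le)
  then have jump: "(\<integral>\<^sup>+\<omega>. shifted_jump N 0 \<omega> \<partial>M) < \<top>"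
    by (rule order.strict_trans1) (simp add: ennreal_mult_less_top)
  have \<xi>_fin: "(\<integral>\<^sup>+\<omega>. abs_powr p (\<xi> (int k) \<omega> / b N) \<partial>M) < \<top>" if "k \<in> {1..N}" for k
  proof -
    have "(\<integral>\<^sup>+\<omega>. abs_powr p (\<xi> (int k) \<omega> / b N) \<partial>M) \<le> (\<integral>\<^sup>+\<omega>. shifted_jump N 0 \<omega> \<partial>M)"
      unfolding shifted_jump_def using that by (intro nn_integral_mono SUP_upper2 [where i = k]) auto
    then show ?thesis using jump by (rule order.strict_trans1)
  qed
  have S_fin: "(\<integral>\<^sup>+\<omega>. abs_powr p (partial_sum \<xi> k \<omega> / b N) \<partial>M) < \<top>" if "k \<le> N" for k
    using that
  proof (induction k)
    case 0
    then show ?case by (simp add: partial_sum_def)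
  next
    case (Suc k)
    have "(\<integral>\<^sup>+\<omega>. abs_powr p (partial_sum \<xi> (Suc k) \<omega> / b N) \<partial>M)
        \<le> (\<integral>\<^sup>+\<omega>. ?c * (abs_powr p (partial_sum \<xi> k \<omega> / b N) + abs_powr p (\<xi> (int (Suc k)) \<omega> / b N)) \<partial>M)"
    proof (rule nn_integral_mono)
      fix \<omega>
      have "partial_sum \<xi> (Suc k) \<omega> / b N = partial_sum \<xi> k \<omega> / b N + \<xi> (int (Suc k)) \<omega> / b N"
        by (simp add: partial_sum_def add_divide_distrib)
      then show "abs_powr p (partial_sum \<xi> (Suc k) \<omega> / b N)
          \<le> ?c * (abs_powr p (partial_sum \<xi> k \<omega> / b N) + abs_powr p (\<xi> (int (Suc k)) \<omega> / b N))"
        by (simp only: abs_powr_add_le [OF p_pos(2)])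
    qed
    also have "\<dots> = ?c * ((\<integral>\<^sup>+\<omega>. abs_powr p (partial_sum \<xi> k \<omega> / b N) \<partial>M)
        + (\<integral>\<^sup>+\<omega>. abs_powr p (\<xi> (int (Suc k)) \<omega> / b N) \<partial>M))"
      by (simp add: nn_integral_cmult nn_integral_add del: of_nat_Suc)
    also have "\<dots> < \<top>"
      using Suc \<xi>_fin [of "Suc k"] by (simp add: ennreal_mult_less_top del: of_nat_Suc)
    finally show ?case .
  qed
  have "(\<integral>\<^sup>+\<omega>. shifted_max N 0 \<omega> \<partial>M)
      \<le> (\<integral>\<^sup>+\<omega>. (\<Sum>k\<in>{..N}. abs_powr p (partial_sum \<xi> k \<omega> / b N)) \<partial>M)"
    unfolding shifted_max_def
    by (intro nn_integral_mono SUP_least) (auto intro!: member_le_sum)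
  also have "\<dots> = (\<Sum>k\<in>{..N}. \<integral>\<^sup>+\<omega>. abs_powr p (partial_sum \<xi> k \<omega> / b N) \<partial>M)"
    by (rule nn_integral_sum) measurable
  also have "\<dots> < \<top>"
    using S_fin by simp
  finally have max_fin: "(\<integral>\<^sup>+\<omega>. shifted_max N 0 \<omega> \<partial>M) < \<top>" .
  define v where "v = (\<integral>\<^sup>+\<omega>. limit_max \<omega> \<partial>M)"
  have "v \<le> (\<integral>\<^sup>+\<omega>. ?c * (shifted_deviation N 0 \<omega> + shifted_max N 0 \<omega>) \<partial>M)"
    unfolding v_def limit_max_def shifted_deviation_def shifted_max_def
    by (intro nn_integral_mono limit_path_le p_pos)
  also have "\<dots> = ?c * ((\<integral>\<^sup>+\<omega>. shifted_deviation N 0 \<omega> \<partial>M) + (\<integral>\<^sup>+\<omega>. shifted_max N 0 \<omega> \<partial>M))"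
    by (simp add: nn_integral_cmult nn_integral_add)
  also have "\<dots> < \<top>"
    using max_fin N(2) [of N] by (auto simp: ennreal_mult_less_top intro: order.strict_trans1)
  finally have v_fin: "v < \<top>" .
  have max_le: "(\<integral>\<^sup>+\<omega>. shifted_max n h \<omega> \<partial>M) \<le> ?c * (1 + v)" if "n \<ge> N" for n h
  proof -
    have "(\<integral>\<^sup>+\<omega>. shifted_max n h \<omega> \<partial>M) = (\<integral>\<^sup>+\<omega>. shifted_max n 0 \<omega> \<partial>M)"
      by (rule nn_integral_shifted_max)
    also have "\<dots> \<le> (\<integral>\<^sup>+\<omega>. ?c * (shifted_deviation n 0 \<omega> + limit_max \<omega>) \<partial>M)"
      unfolding limit_max_def shifted_deviation_def shifted_max_def
      using that N(1) by (intro nn_integral_mono step_path_le p_pos) simp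
    also have "\<dots> = ?c * ((\<integral>\<^sup>+\<omega>. shifted_deviation n 0 \<omega> \<partial>M) + v)"
      by (simp add: nn_integral_cmult nn_integral_add v_def)
    also have "\<dots> \<le> ?c * (1 + v)"
      using N(2) [OF that] by (intro mult_left_mono add_mono) auto
    finally show ?thesis .
  qed
  show ?thesis
  proof (rule that)
    show "?c * (v + ?c * (1 + v)) < \<top>"
      using v_fin by (simp add: ennreal_mult_less_top)
    fix n h assume n: "n \<ge> N"
    have "(\<integral>\<^sup>+\<omega>. shifted_deviation n h \<omega> \<partial>M) \<le> (\<integral>\<^sup>+\<omega>. ?c * (limit_max \<omega> + shifted_max n h \<omega>) \<partial>M)"
      unfolding limit_max_def shifted_deviation_def shifted_max_def
      by (intro nn_integral_mono deviation_le_paths p_pos)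
    also have "\<dots> = ?c * (v + (\<integral>\<^sup>+\<omega>. shifted_max n h \<omega> \<partial>M))"
      by (simp add: nn_integral_cmult nn_integral_add v_def)
    also have "\<dots> \<le> ?c * (v + ?c * (1 + v))"
      using max_le [OF n] by (intro mult_left_mono add_mono) auto
    finally show "(\<integral>\<^sup>+\<omega>. shifted_deviation n h \<omega> \<partial>M) \<le> ?c * (v + ?c * (1 + v))" .
  qed
qed

end

section \<open>Linear processes\<close>

text \<open>Dominated convergence over the index \<open>j\<close>, with respect to counting measure: each summand
  \<open>\<bar>a j\<bar> * \<integral>\<^sup>+\<omega>. shifted_deviation n (- j) \<omega> \<partial>M\<close> vanishes as \<open>n\<close> grows, and for large \<open>n\<close> it is at
  most \<open>\<bar>a j\<bar> * K\<close> with a constant \<open>K\<close>.\<close>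

lemma (in stationary_functional_limit) linear_process_limit:
  assumes a: "(\<lambda>j. \<bar>a j\<bar>) summable_on UNIV"
    and conv: "AE \<omega> in M. \<forall>k. (\<lambda>j. a j * \<xi> (k - j) \<omega>) summable_on UNIV"
  shows "(\<lambda>n. \<integral>\<^sup>+\<omega>. deviation p n (\<lambda>k. partial_sum (linear_process a \<xi>) k \<omega> / b n)
           (\<lambda>t. (\<Sum>\<^sub>\<infinity>j. a j) * V t \<omega>) \<partial>M) \<longlonglongrightarrow> 0"
proof -
  define C where "C = ennreal ((\<Sum>\<^sub>\<infinity>j. \<bar>a j\<bar>) powr (p - 1))"
  define g where "g n = (\<integral>\<^sup>+j. ennreal \<bar>a j\<bar> * (\<integral>\<^sup>+\<omega>. shifted_deviation n (- j) \<omega> \<partial>M) \<partial>count_space UNIV)" for n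
  obtain K N where K: "K < \<top>" "\<And>n h. n \<ge> N \<Longrightarrow> (\<integral>\<^sup>+\<omega>. shifted_deviation n h \<omega> \<partial>M) \<le> K"
    using shifted_deviation_bounded by blast
  have a_fin: "(\<integral>\<^sup>+j. ennreal \<bar>a j\<bar> \<partial>count_space UNIV) < \<top>"
    using a summable_on_iff_nn_integral_abs [of "\<lambda>j. \<bar>a j\<bar>"] by simp
  have "(\<lambda>n. g (n + N)) \<longlonglongrightarrow> (\<integral>\<^sup>+j. 0 \<partial>count_space (UNIV :: int set))"
    unfolding g_def
  proof (rule nn_integral_dominated_convergence [where w = "\<lambda>j. ennreal \<bar>a j\<bar> * K"])
    show "AE j in count_space UNIV. ennreal \<bar>a j\<bar> * (\<integral>\<^sup>+\<omega>. shifted_deviation (n + N) (- j) \<omega> \<partial>M)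
        \<le> ennreal \<bar>a j\<bar> * K" for n
      by (intro AE_I2 mult_left_mono K(2)) auto
    have "(\<integral>\<^sup>+j. ennreal \<bar>a j\<bar> * K \<partial>count_space UNIV) = (\<integral>\<^sup>+j. ennreal \<bar>a j\<bar> \<partial>count_space UNIV) * K"
      by (simp add: nn_integral_multc)
    then show "(\<integral>\<^sup>+j. ennreal \<bar>a j\<bar> * K \<partial>count_space UNIV) < \<infinity>"
      using a_fin K(1) by (simp add: ennreal_mult_less_top)
    have "(\<lambda>n. ennreal \<bar>a j\<bar> * (\<integral>\<^sup>+\<omega>. shifted_deviation (n + N) (- j) \<omega> \<partial>M)) \<longlonglongrightarrow> ennreal \<bar>a j\<bar> * 0" for j
      by (intro ennreal_tendsto_cmult LIMSEQ_ignore_initial_segment shifted_deviation_tendsto) simp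
    then show "AE j in count_space UNIV.
        (\<lambda>n. ennreal \<bar>a j\<bar> * (\<integral>\<^sup>+\<omega>. shifted_deviation (n + N) (- j) \<omega> \<partial>M)) \<longlonglongrightarrow> 0"
      by simp
  qed simp_all
  then have "g \<longlonglongrightarrow> 0"
    by (simp add: LIMSEQ_offset)
  then have "(\<lambda>n. C * g n) \<longlonglongrightarrow> C * 0"
    by (intro ennreal_tendsto_cmult) (simp_all add: C_def)
  then have "(\<lambda>n. C * g n) \<longlonglongrightarrow> 0" by simp
  then show ?thesis
  proof (rule tendsto_zero_ennreal_majorant)
    fix n :: nat
    have "(\<integral>\<^sup>+\<omega>. deviation p n (\<lambda>k. partial_sum (linear_process a \<xi>) k \<omega> / b n) (\<lambda>t. (\<Sum>\<^sub>\<infinity>j. a j) * V t \<omega>) \<partial>M)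
        \<le> (\<integral>\<^sup>+\<omega>. C * (\<integral>\<^sup>+j. ennreal \<bar>a j\<bar> * shifted_deviation n (- j) \<omega> \<partial>count_space UNIV) \<partial>M)"
    proof (rule nn_integral_mono_AE)
      show "AE \<omega> in M. deviation p n (\<lambda>k. partial_sum (linear_process a \<xi>) k \<omega> / b n) (\<lambda>t. (\<Sum>\<^sub>\<infinity>j. a j) * V t \<omega>)
          \<le> C * (\<integral>\<^sup>+j. ennreal \<bar>a j\<bar> * shifted_deviation n (- j) \<omega> \<partial>count_space UNIV)"
        using conv
      proof eventually_elim
        case (elim \<omega>)
        have "((\<lambda>j. a j * (partial_sum (\<lambda>i. \<xi> (i + - j)) k \<omega> / b n)) has_sum
            partial_sum (linear_process a \<xi>) k \<omega> / b n) UNIV" for k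
          using has_sum_cmult_left [OF partial_sum_linear_process_has_sum [of a \<xi> \<omega> k], of "1 / b n"] elim
          by simp
        from deviation_linear_combination_le [OF p_ge_1 a this] show ?case
          unfolding C_def shifted_deviation_def .
      qed
    qed
    also have "\<dots> = C * (\<integral>\<^sup>+\<omega>. (\<integral>\<^sup>+j. ennreal \<bar>a j\<bar> * shifted_deviation n (- j) \<omega> \<partial>count_space UNIV) \<partial>M)"
      by (intro nn_integral_cmult borel_measurable_nn_integral_count_space) measurable
    also have "(\<integral>\<^sup>+\<omega>. (\<integral>\<^sup>+j. ennreal \<bar>a j\<bar> * shifted_deviation n (- j) \<omega> \<partial>count_space UNIV) \<partial>M) = g n"
      unfolding g_def by (subst nn_integral_count_space_nn_integral) (auto simp: nn_integral_cmult)
    finally show "(\<integral>\<^sup>+\<omega>. deviation p n (\<lambda>k. partial_sum (linear_process a \<xi>) k \<omega> / b n) (\<lambda>t. (\<Sum>\<^sub>\<infinity>j. a j) * V t \<omega>) \<partial>M)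
        \<le> C * g n" .
  qed
qed

lemma invariant_field_measurable:
  assumes "\<And>i. \<xi> i \<in> borel_measurable M" "f \<in> borel_measurable (invariant_field M \<xi>)"
  shows "f \<in> borel_measurable M"
proof (rule measurable_mono [THEN subsetD, OF _ _ _ _ assms(2)])
  have "(\<lambda>\<omega> i. \<xi> i \<omega>) \<in> measurable M (\<Pi>\<^sub>M i\<in>UNIV. borel)"
    using assms(1) by (intro measurable_abs_UNIV)
  then show "sets (invariant_field M \<xi>) \<subseteq> sets M"
    by (auto simp: sets_invariant_field intro: measurable_sets)
qed auto

text \<open>The supremum over the uncountable index set need not be measurable. By path
  continuity it agrees almost everywhere with \<open>deviation\<close>, which is measurable for measurable \<open>s\<close>
  and \<open>V\<close>, and \<open>nn_integral\<close> does not distinguish functions that agree almost everywhere.\<close>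

lemma nn_integral_SUP_eq_deviation:
  assumes "p > 0" and "AE \<omega> in M. continuous_on {0..1} (\<lambda>t. V t \<omega>)"
  shows "(\<integral>\<^sup>+\<omega>. (SUP t\<in>{0..1}. ennreal (\<bar>s (nat \<lfloor>real n * t\<rfloor>) \<omega> - V t \<omega>\<bar> powr p)) \<partial>M)
    = (\<integral>\<^sup>+\<omega>. deviation p n (\<lambda>k. s k \<omega>) (\<lambda>t. V t \<omega>) \<partial>M)"
proof (rule nn_integral_cong_AE)
  show "AE \<omega> in M. (SUP t\<in>{0..1}. ennreal (\<bar>s (nat \<lfloor>real n * t\<rfloor>) \<omega> - V t \<omega>\<bar> powr p))
      = deviation p n (\<lambda>k. s k \<omega>) (\<lambda>t. V t \<omega>)"
    using assms(2)
  proof eventually_elim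
    case (elim \<omega>)
    from SUP_unit_interval_eq_deviation [OF assms(1) this, of "\<lambda>k. s k \<omega>" n]
    show ?case by (simp add: abs_powr_def)
  qed
qed

theorem corollary6:
  fixes M :: "'a measure"
    and \<xi> :: "int \<Rightarrow> 'a \<Rightarrow> real"
    and a :: "int \<Rightarrow> real"
    and p :: real
    and b :: "nat \<Rightarrow> real"
    and \<eta> :: "'a \<Rightarrow> real"
    and W :: "real \<Rightarrow> 'a \<Rightarrow> real"
  assumes "prob_space M"
    and "stationary_sequence M \<xi>"
    and "integrable M (\<xi> 0)"
    and "(\<integral>\<omega>. \<xi> 0 \<omega> \<partial>M) = 0"
    and "(\<lambda>j. \<bar>a j\<bar>) summable_on UNIV"
    and "p \<ge> 1"
    and "\<And>n. n \<ge> 1 \<Longrightarrow> b n > 0"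
    and "filterlim b at_top sequentially"
    and "\<eta> \<in> borel_measurable (invariant_field M \<xi>)"
    and "standard_brownian_motion M W"
    and "prob_space.indep_set M (sets (process_field M W)) (sets (invariant_field M \<xi>))"
    and "(\<lambda>n::nat. \<integral>\<^sup>+\<omega>. (SUP t\<in>{0..1}. ennreal
            (\<bar>partial_sum \<xi> (nat \<lfloor>real n * t\<rfloor>) \<omega> / b n - \<eta> \<omega> * W t \<omega>\<bar> powr p)) \<partial>M)
          \<longlonglongrightarrow> 0"
  shows "(\<lambda>n::nat. \<integral>\<^sup>+\<omega>. (SUP t\<in>{0..1}. ennreal
            (\<bar>partial_sum (linear_process a \<xi>) (nat \<lfloor>real n * t\<rfloor>) \<omega> / b n
               - \<eta> \<omega> * (\<Sum>\<^sub>\<infinity>j\<in>UNIV. a j) * W t \<omega>\<bar> powr p)) \<partial>M)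
          \<longlonglongrightarrow> 0"
proof -
  let ?A = "\<Sum>\<^sub>\<infinity>j\<in>UNIV. a j"
  have p: "p > 0" using \<open>p \<ge> 1\<close> by simp
  note \<xi> [measurable] = stationary_sequence_measurable [OF \<open>stationary_sequence M \<xi>\<close>]
  have \<eta> [measurable]: "\<eta> \<in> borel_measurable M"
    using \<xi> \<open>\<eta> \<in> borel_measurable (invariant_field M \<xi>)\<close> by (rule invariant_field_measurable)
  have W: "W t \<in> borel_measurable M" if "t \<in> {0..1}" for t
    using that \<open>standard_brownian_motion M W\<close> by (simp add: standard_brownian_motion_def)
  have W_cont: "AE \<omega> in M. continuous_on {0..1} (\<lambda>t. W t \<omega>)"
    using \<open>standard_brownian_motion M W\<close> by (auto simp: standard_brownian_motion_def)
  have V_cont: "AE \<omega> in M. continuous_on {0..1} (\<lambda>t. \<eta> \<omega> * W t \<omega>)"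
    using W_cont by eventually_elim (intro continuous_intros)
  have AV_cont: "AE \<omega> in M. continuous_on {0..1} (\<lambda>t. ?A * (\<eta> \<omega> * W t \<omega>))"
    using W_cont by eventually_elim (intro continuous_intros)
  interpret stationary_functional_limit M \<xi> b p "\<lambda>t \<omega>. \<eta> \<omega> * W t \<omega>"
  proof
    show "t \<in> {0..1} \<Longrightarrow> (\<lambda>\<omega>. \<eta> \<omega> * W t \<omega>) \<in> borel_measurable M" for t
      using W [of t] by measurable
    show "(\<lambda>n. \<integral>\<^sup>+\<omega>. deviation p n (\<lambda>k. partial_sum \<xi> k \<omega> / b n) (\<lambda>t. \<eta> \<omega> * W t \<omega>) \<partial>M) \<longlonglongrightarrow> 0"
      using assms(12)
      by (simp only: nn_integral_SUP_eq_deviation [OF p V_cont,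
            where s = "\<lambda>k \<omega>. partial_sum \<xi> k \<omega> / b n" and n = n for n])
  qed (use assms V_cont in auto)
  have "(\<lambda>n. \<integral>\<^sup>+\<omega>. deviation p n (\<lambda>k. partial_sum (linear_process a \<xi>) k \<omega> / b n)
      (\<lambda>t. ?A * (\<eta> \<omega> * W t \<omega>)) \<partial>M) \<longlonglongrightarrow> 0"
    using assms by (intro linear_process_limit AE_linear_process_summable)
  moreover have "x * ?A * y = ?A * (x * y)" for x y :: real
    by simp
  ultimately show ?thesis
    by (simp only: nn_integral_SUP_eq_deviation [OF p AV_cont,
          where s = "\<lambda>k \<omega>. partial_sum (linear_process a \<xi>) k \<omega> / b n" and n = n for n])
qed

end
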